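(* Let $X$ be a compact, connected and locally path connected topological space and let $f,g : X\to\mathbb{R}$ be two continuous functions. Then $$d_{GH}(T_f,T_g) \le 2\,\|f-g\|_{L^\infty}.$$
   Context: $d_{GH}$ is the Gromov–Hausdorff distance between compact metric spaces. For a continuous $f:X\to\mathbb{R}$ and $x,y\in X$ put $d_f(x,y) := f(x)+f(y) - 2\sup_{\gamma : x\mapsto y}\inf_{t\in[0,1]} f(\gamma(t))$, the supremum being over continuous paths $\gamma:[0,1]\to X$ from $x$ to $y$. This is a pseudo-distance on $X$, and $T_f := X/\{d_f=0\}$ is the quotient metric space with the induced distance $d_f$ (an $\mathbb{R}$-tree). *)

theory Defs
  imports "HOL-Analysis.Analysis"
begin

section \<open>Gromov--Hausdorff distance\<close>

definition hausdorff_distance :: "'a metric \<Rightarrow> 'a set \<Rightarrow> 'a set \<Rightarrow> real" where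
  "hausdorff_distance m A B =
     Inf {r. r > 0 \<and> A \<subseteq> (\<Union>b\<in>B. mball_of m b r) \<and> B \<subseteq> (\<Union>a\<in>A. mball_of m a r)}"

definition isometric_embedding :: "'a metric \<Rightarrow> 'b metric \<Rightarrow> ('a \<Rightarrow> 'b) \<Rightarrow> bool" where
  "isometric_embedding m1 m2 \<phi> \<longleftrightarrow>
     \<phi> \<in> mspace m1 \<rightarrow> mspace m2 \<and>
     (\<forall>x\<in>mspace m1. \<forall>y\<in>mspace m1. mdist m2 (\<phi> x) (\<phi> y) = mdist m1 x y)"

text \<open>
  The infimum ranges over the metric spaces whose points lie in the type \<open>'a + 'b\<close>.
  This is no restriction: only the union of the two images matters, and it always
  injects into \<open>'a + 'b\<close>.  Lemma \<open>gromov_hausdorff_ambient\<close> below makes this precise.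
\<close>

definition gromov_hausdorff_distance :: "'a metric \<Rightarrow> 'b metric \<Rightarrow> real" where
  "gromov_hausdorff_distance m1 m2 =
     Inf {hausdorff_distance Z (\<phi> ` mspace m1) (\<psi> ` mspace m2) | (Z :: ('a + 'b) metric) \<phi> \<psi>.
            isometric_embedding m1 Z \<phi> \<and> isometric_embedding m2 Z \<psi>}"

lemma gromov_hausdorff_ambient:
  fixes Z :: "'c metric" and m1 :: "'a metric" and m2 :: "'b metric"
  assumes "isometric_embedding m1 Z \<phi>" "isometric_embedding m2 Z \<psi>"
  shows "\<exists>(Z' :: ('a + 'b) metric) \<phi>' \<psi>'.
           isometric_embedding m1 Z' \<phi>' \<and> isometric_embedding m2 Z' \<psi>' \<and>
           hausdorff_distance Z' (\<phi>' ` mspace m1) (\<psi>' ` mspace m2) =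
           hausdorff_distance Z (\<phi> ` mspace m1) (\<psi> ` mspace m2)"
proof -
  let ?A = "\<phi> ` mspace m1" and ?B = "\<psi> ` mspace m2"
  define h :: "'c \<Rightarrow> 'a + 'b" where
    "h z = (if z \<in> ?A then Inl (inv_into (mspace m1) \<phi> z) else Inr (inv_into (mspace m2) \<psi> z))" for z
  define U where "U = ?A \<union> ?B"
  have AU: "?A \<subseteq> U" "?B \<subseteq> U"
    by (auto simp: U_def)
  have inj: "inj_on h U"
    unfolding U_def inj_on_def h_def by (auto dest: inv_into_injective split: if_splits)
  define k where "k = inv_into U h"
  have k: "k (h z) = z" if "z \<in> U" for z
    using inj that unfolding k_def by (rule inv_into_f_f)
  have sub: "U \<subseteq> mspace Z"
    using assms by (auto simp: U_def isometric_embedding_def)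
  define N where "N = h ` U"
  define d where "d x y = (if x \<in> N \<and> y \<in> N then mdist Z (k x) (k y) else 0)" for x y
  have kN: "k x \<in> mspace Z" if "x \<in> N" for x
    using that sub by (auto simp: N_def k)
  have kinj: "k x = k y \<longleftrightarrow> x = y" if "x \<in> N" "y \<in> N" for x y
    using that by (auto simp: N_def k)
  have met: "Metric_space N d"
  proof
    show "d x y = d y x" for x y by (simp add: d_def mdist_commute)
    show "d x z \<le> d x y + d y z" if "x \<in> N" "y \<in> N" "z \<in> N" for x y z
      using that kN by (simp add: d_def mdist_triangle)
  qed (use kN kinj in \<open>auto simp: d_def\<close>)
  define Z' where "Z' = metric (N, d)"
  have Z': "mspace Z' = N" "mdist Z' = d"
    using met by (simp_all add: Z'_def Metric_space.mspace_metric Metric_space.mdist_metric)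
  have dh: "d (h a) (h b) = mdist Z a b" if "a \<in> U" "b \<in> U" for a b
    using that by (simp add: d_def N_def k)
  have iso1: "isometric_embedding m1 Z' (h \<circ> \<phi>)" and iso2: "isometric_embedding m2 Z' (h \<circ> \<psi>)"
    using assms AU by (auto simp: isometric_embedding_def Z' dh N_def image_subset_iff)
  have ball: "h a \<in> mball_of Z' (h b) r \<longleftrightarrow> a \<in> mball_of Z b r"
    if "a \<in> U" "b \<in> U" for a b r
  proof -
    have "a \<in> mspace Z" "b \<in> mspace Z" "h a \<in> N" "h b \<in> N"
      using that sub by (auto simp: N_def)
    then show ?thesis by (simp add: Z' dh that)
  qed
  have cover: "h ` C \<subseteq> (\<Union>b\<in>h ` D. mball_of Z' b r) \<longleftrightarrow> C \<subseteq> (\<Union>b\<in>D. mball_of Z b r)"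
    if "C \<subseteq> U" "D \<subseteq> U" for C D r
  proof -
    have "h ` C \<subseteq> (\<Union>b\<in>h ` D. mball_of Z' b r) \<longleftrightarrow> (\<forall>a\<in>C. \<exists>b\<in>D. h a \<in> mball_of Z' (h b) r)"
      by blast
    also have "\<dots> \<longleftrightarrow> (\<forall>a\<in>C. \<exists>b\<in>D. a \<in> mball_of Z b r)"
      using ball that by (meson subsetD)
    finally show ?thesis by blast
  qed
  have "hausdorff_distance Z' (h ` ?A) (h ` ?B) = hausdorff_distance Z ?A ?B"
    unfolding hausdorff_distance_def cover[OF AU] cover[OF AU(2) AU(1)] ..
  then show ?thesis
    using iso1 iso2
    by (intro exI[of _ Z'] exI[of _ "h \<circ> \<phi>"] exI[of _ "h \<circ> \<psi>"]) (simp add: image_comp)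
qed


section \<open>The tree of a function\<close>

definition paths_between :: "'a topology \<Rightarrow> 'a \<Rightarrow> 'a \<Rightarrow> (real \<Rightarrow> 'a) set" where
  "paths_between X x y = {\<gamma>. pathin X \<gamma> \<and> \<gamma> 0 = x \<and> \<gamma> 1 = y}"

definition tree_dist :: "'a topology \<Rightarrow> ('a \<Rightarrow> real) \<Rightarrow> 'a \<Rightarrow> 'a \<Rightarrow> real" where
  "tree_dist X f x y = f x + f y - 2 * (SUP \<gamma>\<in>paths_between X x y. INF t\<in>{0..1}. f (\<gamma> t))"

definition tree_rel :: "'a topology \<Rightarrow> ('a \<Rightarrow> real) \<Rightarrow> ('a \<times> 'a) set" where
  "tree_rel X f = {(x, y). x \<in> topspace X \<and> y \<in> topspace X \<and> tree_dist X f x y = 0}"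

text \<open>
  The distance of two classes is computed on arbitrary representatives; the value \<open>0\<close> off the
  carrier is needed only because \<^term>\<open>Metric_space\<close> wants a symmetric nonnegative function on the
  whole type.  Lemma \<open>tree_metric\<close> shows that \<open>tree X f\<close> really is the quotient metric
  space whenever \<open>X\<close> is path connected and compact and \<open>f\<close> is continuous.
\<close>

definition tree_class_dist :: "'a topology \<Rightarrow> ('a \<Rightarrow> real) \<Rightarrow> 'a set \<Rightarrow> 'a set \<Rightarrow> real" where
  "tree_class_dist X f A B =
     (if A \<in> topspace X // tree_rel X f \<and> B \<in> topspace X // tree_rel X f
      then tree_dist X f (SOME x. x \<in> A) (SOME y. y \<in> B) else 0)"

definition tree :: "'a topology \<Rightarrow> ('a \<Rightarrow> real) \<Rightarrow> 'a set metric" where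
  "tree X f = metric (topspace X // tree_rel X f, tree_class_dist X f)"

text \<open>The case distinction only fixes the norm on the empty space, where the supremum is unspecified.\<close>

definition sup_norm :: "'a topology \<Rightarrow> ('a \<Rightarrow> real) \<Rightarrow> real" where
  "sup_norm X h = (if topspace X = {} then 0 else SUP x\<in>topspace X. \<bar>h x\<bar>)"


subsection \<open>The quotient is a metric space\<close>

context
  fixes X :: "'a topology" and f :: "'a \<Rightarrow> real"
  assumes compact: "compact_space X" and pc: "path_connected_space X"
    and cont: "continuous_map X euclideanreal f"
begin

private abbreviation level where
  "level x y \<equiv> (SUP \<gamma>\<in>paths_between X x y. INF t\<in>{0..1}. f (\<gamma> t))"

private lemma f_bounds: "\<exists>B. \<forall>x\<in>topspace X. \<bar>f x\<bar> \<le> B"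
proof -
  have "compact (f ` topspace X)"
    using compact cont image_compactin unfolding compact_space_def by fastforce
  then show ?thesis
    by (auto simp: bounded_iff dest!: compact_imp_bounded)
qed

private lemma path_in_space:
  assumes "\<gamma> \<in> paths_between X x y" "t \<in> {0..1}"
  shows "\<gamma> t \<in> topspace X"
  using assms unfolding paths_between_def pathin_def
  by (auto dest!: continuous_map_image_subset_topspace)

private lemma inf_bdd: "\<gamma> \<in> paths_between X x y \<Longrightarrow> bdd_below ((\<lambda>t. f (\<gamma> t)) ` {0..1})"
  using f_bounds path_in_space by (meson abs_le_D2 bdd_belowI2 minus_le_iff)

private lemma inf_le: "\<gamma> \<in> paths_between X x y \<Longrightarrow> t \<in> {0..1} \<Longrightarrow> (INF t\<in>{0..1}. f (\<gamma> t)) \<le> f (\<gamma> t)"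
  by (rule cINF_lower[OF inf_bdd])

private lemma inf_le_ends:
  assumes "\<gamma> \<in> paths_between X x y"
  shows "(INF t\<in>{0..1}. f (\<gamma> t)) \<le> f x" "(INF t\<in>{0..1}. f (\<gamma> t)) \<le> f y"
  using inf_le[OF assms, of 0] inf_le[OF assms, of 1] assms by (auto simp: paths_between_def)

private lemma paths_nonempty: "x \<in> topspace X \<Longrightarrow> y \<in> topspace X \<Longrightarrow> paths_between X x y \<noteq> {}"
  using pc unfolding path_connected_space_def paths_between_def by blast

private lemma sup_bdd: "bdd_above ((\<lambda>\<gamma>. INF t\<in>{0..1}. f (\<gamma> t)) ` paths_between X x y)"
  using inf_le_ends by (meson bdd_aboveI2)

private lemma level_le:
  assumes "x \<in> topspace X" "y \<in> topspace X"
  shows "level x y \<le> f x" "level x y \<le> f y"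
  by (rule cSUP_least[OF paths_nonempty[OF assms]]; simp add: inf_le_ends)+

private lemma level_self:
  assumes "x \<in> topspace X"
  shows "level x x = f x"
proof (rule antisym)
  have *: "(\<lambda>t. x) \<in> paths_between X x x"
    using assms by (simp add: paths_between_def pathin_const)
  show "f x \<le> level x x"
    using cSUP_upper[OF * sup_bdd] by simp
qed (rule level_le[OF assms assms])

private lemma reverse_path: "\<gamma> \<in> paths_between X x y \<Longrightarrow> (\<lambda>t. \<gamma> (1 - t)) \<in> paths_between X y x"
proof -
  assume g: "\<gamma> \<in> paths_between X x y"
  have "continuous_map (top_of_set {0..1::real}) (top_of_set {0..1}) (\<lambda>t. 1 - t)"
    by (auto intro!: continuous_intros)
  then have "continuous_map (top_of_set {0..1}) X (\<gamma> \<circ> (\<lambda>t. 1 - t))"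
    using g continuous_map_compose unfolding paths_between_def pathin_def by blast
  then show ?thesis
    using g by (simp add: paths_between_def pathin_def o_def)
qed

private lemma level_commute: "level x y = level y x"
proof -
  have rev: "(INF t\<in>{0..1}. f (\<gamma> (1 - t))) = (INF t\<in>{0..1}. f (\<gamma> t))" for \<gamma> :: "real \<Rightarrow> 'a"
  proof -
    have "(\<lambda>t. f (\<gamma> (1 - t))) ` {0..1} = (\<lambda>t. f (\<gamma> t)) ` ((\<lambda>t::real. 1 - t) ` {0..1})"
      by (simp only: image_image)
    then show ?thesis by simp
  qed
  have sub: "(\<lambda>\<gamma>. INF t\<in>{0..1}. f (\<gamma> t)) ` paths_between X x y
     \<subseteq> (\<lambda>\<gamma>. INF t\<in>{0..1}. f (\<gamma> t)) ` paths_between X y x" for x y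
  proof
    fix s assume "s \<in> (\<lambda>\<gamma>. INF t\<in>{0..1}. f (\<gamma> t)) ` paths_between X x y"
    then obtain \<gamma> where "\<gamma> \<in> paths_between X x y" "s = (INF t\<in>{0..1}. f (\<gamma> t))" by blast
    then show "s \<in> (\<lambda>\<gamma>. INF t\<in>{0..1}. f (\<gamma> t)) ` paths_between X y x"
      using reverse_path rev[of \<gamma>] by (intro image_eqI[of _ _ "\<lambda>t. \<gamma> (1 - t)"]) auto
  qed
  show ?thesis
    using sub[of x y] sub[of y x] by (simp add: subset_antisym)
qed

private lemma join_paths:
  assumes g: "\<gamma> \<in> paths_between X x y" and h: "\<delta> \<in> paths_between X y z"
  shows "(\<lambda>t. if t \<le> 1/2 then \<gamma> (2 * t) else \<delta> (2 * t - 1)) \<in> paths_between X x z"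
proof -
  let ?I = "top_of_set {0..1::real}"
  have "continuous_map ?I X (\<lambda>t. if t \<le> 1/2 then \<gamma> (2 * t) else \<delta> (2 * t - 1))"
  proof (rule continuous_map_cases_le)
    show "continuous_map ?I euclideanreal (\<lambda>t. t)" "continuous_map ?I euclideanreal (\<lambda>t. 1/2)"
      by auto
    have "continuous_map (subtopology ?I {t \<in> topspace ?I. t \<le> 1/2}) ?I (\<lambda>t. 2 * t)"
      by (auto simp: subtopology_subtopology intro!: continuous_intros)
    then show "continuous_map (subtopology ?I {t \<in> topspace ?I. t \<le> 1/2}) X (\<lambda>t. \<gamma> (2 * t))"
      using g continuous_map_compose[of _ ?I "\<lambda>t. 2 * t" X \<gamma>]
      by (simp add: paths_between_def pathin_def o_def)
    have "continuous_map (subtopology ?I {t \<in> topspace ?I. 1/2 \<le> t}) ?I (\<lambda>t. 2 * t - 1)"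
      by (auto simp: subtopology_subtopology intro!: continuous_intros)
    then show "continuous_map (subtopology ?I {t \<in> topspace ?I. 1/2 \<le> t}) X (\<lambda>t. \<delta> (2 * t - 1))"
      using h continuous_map_compose[of _ ?I "\<lambda>t. 2 * t - 1" X \<delta>]
      by (simp add: paths_between_def pathin_def o_def)
    show "\<gamma> (2 * t) = \<delta> (2 * t - 1)" if "t \<in> topspace ?I" "t = 1/2" for t
    proof -
      have "2 * t = 1" "2 * t - 1 = 0" using that by auto
      then show ?thesis using g h by (simp add: paths_between_def)
    qed
  qed
  then show ?thesis
    using g h by (simp add: paths_between_def pathin_def)
qed

private lemma level_trans:
  assumes "x \<in> topspace X" "y \<in> topspace X" "z \<in> topspace X"
  shows "min (level x y) (level y z) \<le> level x z"
proof (rule ccontr)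
  assume "\<not> ?thesis"
  then have "level x z < level x y" "level x z < level y z" by auto
  then obtain \<gamma> \<delta> where g: "\<gamma> \<in> paths_between X x y" "level x z < (INF t\<in>{0..1}. f (\<gamma> t))"
    and h: "\<delta> \<in> paths_between X y z" "level x z < (INF t\<in>{0..1}. f (\<delta> t))"
    using assms by (auto simp: less_cSUP_iff[OF paths_nonempty sup_bdd])
  define \<eta> where "\<eta> t = (if t \<le> 1/2 then \<gamma> (2 * t) else \<delta> (2 * t - 1))" for t
  have e: "\<eta> \<in> paths_between X x z"
    using join_paths[OF g(1) h(1)] unfolding \<eta>_def .
  have "min (INF t\<in>{0..1}. f (\<gamma> t)) (INF t\<in>{0..1}. f (\<delta> t)) \<le> (INF t\<in>{0..1}. f (\<eta> t))"
  proof (rule cINF_greatest)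
    fix t :: real assume t: "t \<in> {0..1}"
    show "min (INF t\<in>{0..1}. f (\<gamma> t)) (INF t\<in>{0..1}. f (\<delta> t)) \<le> f (\<eta> t)"
    proof (cases "t \<le> 1/2")
      case True
      then show ?thesis
        using inf_le[OF g(1), of "2 * t"] t by (auto simp: \<eta>_def min_le_iff_disj)
    next
      case False
      then show ?thesis
        using inf_le[OF h(1), of "2 * t - 1"] t by (auto simp: \<eta>_def min_le_iff_disj)
    qed
  qed simp
  also have "\<dots> \<le> level x z"
    by (rule cSUP_upper[OF e sup_bdd])
  finally show False using g(2) h(2) by auto
qed

lemma tree_dist_nonneg: "x \<in> topspace X \<Longrightarrow> y \<in> topspace X \<Longrightarrow> 0 \<le> tree_dist X f x y"
  using level_le[of x y] unfolding tree_dist_def by linarith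

lemma tree_dist_self: "x \<in> topspace X \<Longrightarrow> tree_dist X f x x = 0"
  by (simp add: tree_dist_def level_self)

lemma tree_dist_commute: "tree_dist X f x y = tree_dist X f y x"
  by (simp add: tree_dist_def level_commute[of x y])

lemma tree_dist_triangle:
  assumes "x \<in> topspace X" "y \<in> topspace X" "z \<in> topspace X"
  shows "tree_dist X f x z \<le> tree_dist X f x y + tree_dist X f y z"
  using level_trans[OF assms] level_le(2)[of x y] level_le(1)[of y z] assms
  unfolding tree_dist_def by linarith

lemma equiv_tree_rel: "equiv (topspace X) (tree_rel X f)"
proof (rule equivI)
  show "tree_rel X f \<subseteq> topspace X \<times> topspace X"
    by (auto simp: tree_rel_def)
  show "refl_on (topspace X) (tree_rel X f)"
    by (auto simp: refl_on_def tree_rel_def tree_dist_self)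
  show "sym (tree_rel X f)"
    by (auto simp: sym_def tree_rel_def tree_dist_commute)
  show "trans (tree_rel X f)"
  proof (rule transI)
    fix x y z assume "(x, y) \<in> tree_rel X f" "(y, z) \<in> tree_rel X f"
    then show "(x, z) \<in> tree_rel X f"
      using tree_dist_triangle[of x y z] tree_dist_nonneg[of x z] by (simp add: tree_rel_def)
  qed
qed

private lemma tree_dist_cong:
  assumes "(x, x') \<in> tree_rel X f" "(y, y') \<in> tree_rel X f"
  shows "tree_dist X f x y = tree_dist X f x' y'"
proof -
  have "tree_dist X f a b \<le> tree_dist X f a' b'"
    if "(a, a') \<in> tree_rel X f" "(b, b') \<in> tree_rel X f" for a a' b b'
    using that tree_dist_triangle[of a a' b] tree_dist_triangle[of a' b' b]
    by (simp add: tree_rel_def tree_dist_commute[of b' b])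
  then show ?thesis
    using assms equiv_tree_rel by (meson antisym equivE symD)
qed

private lemma class_dist:
  assumes "x \<in> topspace X" "y \<in> topspace X"
  shows "tree_class_dist X f (tree_rel X f `` {x}) (tree_rel X f `` {y}) = tree_dist X f x y"
proof -
  have "(z, SOME w. w \<in> tree_rel X f `` {z}) \<in> tree_rel X f" if "z \<in> topspace X" for z
    using that someI[of "\<lambda>w. w \<in> tree_rel X f `` {z}" z] equiv_class_self[OF equiv_tree_rel] by auto
  then have "tree_dist X f x y =
      tree_dist X f (SOME w. w \<in> tree_rel X f `` {x}) (SOME w. w \<in> tree_rel X f `` {y})"
    using assms tree_dist_cong by blast
  then show ?thesis
    using assms by (simp add: tree_class_dist_def quotientI)
qed

lemma tree_metric:
  shows "Metric_space (topspace X // tree_rel X f) (tree_class_dist X f)"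
    and "mspace (tree X f) = topspace X // tree_rel X f"
    and "x \<in> topspace X \<Longrightarrow> y \<in> topspace X \<Longrightarrow>
           mdist (tree X f) (tree_rel X f `` {x}) (tree_rel X f `` {y}) = tree_dist X f x y"
proof -
  show met: "Metric_space (topspace X // tree_rel X f) (tree_class_dist X f)"
  proof
    fix A B
    show "0 \<le> tree_class_dist X f A B"
    proof (cases "A \<in> topspace X // tree_rel X f \<and> B \<in> topspace X // tree_rel X f")
      case True
      then show ?thesis by (auto elim!: quotientE simp: class_dist tree_dist_nonneg)
    qed (auto simp: tree_class_dist_def)
    show "tree_class_dist X f A B = tree_class_dist X f B A"
      by (simp add: tree_class_dist_def tree_dist_commute conj_commute)
  next
    fix A B assume "A \<in> topspace X // tree_rel X f" "B \<in> topspace X // tree_rel X f"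
    then obtain x y where xy: "x \<in> topspace X" "y \<in> topspace X"
      "A = tree_rel X f `` {x}" "B = tree_rel X f `` {y}" by (auto elim!: quotientE)
    have "tree_class_dist X f A B = 0 \<longleftrightarrow> (x, y) \<in> tree_rel X f"
      unfolding xy class_dist[OF xy(1,2)] using xy(1,2) by (simp add: tree_rel_def)
    also have "\<dots> \<longleftrightarrow> A = B"
      using eq_equiv_class_iff[OF equiv_tree_rel] xy by simp
    finally show "tree_class_dist X f A B = 0 \<longleftrightarrow> A = B" .
  next
    fix A B C
    assume "A \<in> topspace X // tree_rel X f" "B \<in> topspace X // tree_rel X f"
      "C \<in> topspace X // tree_rel X f"
    then show "tree_class_dist X f A C \<le> tree_class_dist X f A B + tree_class_dist X f B C"
      by (auto elim!: quotientE simp: class_dist tree_dist_triangle)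
  qed
  show "mspace (tree X f) = topspace X // tree_rel X f"
    by (simp add: tree_def Metric_space.mspace_metric[OF met])
  show "mdist (tree X f) (tree_rel X f `` {x}) (tree_rel X f `` {y}) = tree_dist X f x y"
    if "x \<in> topspace X" "y \<in> topspace X"
    using that by (simp add: tree_def Metric_space.mdist_metric[OF met] class_dist)
qed

end

end

theory Submission
  imports Defs
begin

text \<open>
  The identity of \<open>X\<close> induces a correspondence between the two trees. Moving from \<open>f\<close> to \<open>g\<close>
  changes the infimum along each path by at most the sup norm \<open>s\<close> of \<open>f - g\<close>, so the two
  pseudo-distances differ by at most \<open>4 * s\<close>. A correspondence of distortion at most \<open>2 * r\<close>
  yields a metric on the disjoint sum, in which related points are at distance \<open>r\<close>.
\<close>

section \<open>Upper bounds for Hausdorff and Gromov-Hausdorff distances\<close>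

lemma hausdorff_distance_le:
  assumes "0 \<le> r"
    and "\<And>a. a \<in> A \<Longrightarrow> \<exists>b\<in>B. a \<in> mspace m \<and> b \<in> mspace m \<and> mdist m a b \<le> r"
    and "\<And>b. b \<in> B \<Longrightarrow> \<exists>a\<in>A. a \<in> mspace m \<and> b \<in> mspace m \<and> mdist m a b \<le> r"
  shows "hausdorff_distance m A B \<le> r"
\<comment> \<open>The balls are open and radii are positive, so the bound \<open>r\<close> itself
  may fail to be admissible, while every \<open>r + e\<close> is.\<close>
proof (rule field_le_epsilon)
  fix e :: real assume e: "0 < e"
  have "A \<subseteq> (\<Union>b\<in>B. mball_of m b (r + e))"
  proof
    fix a assume "a \<in> A"
    then obtain b where "b \<in> B" "a \<in> mspace m" "b \<in> mspace m" "mdist m a b \<le> r"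
      using assms(2) by blast
    then show "a \<in> (\<Union>b\<in>B. mball_of m b (r + e))"
      using e by (auto simp: mdist_commute intro!: bexI[of _ b])
  qed
  moreover have "B \<subseteq> (\<Union>a\<in>A. mball_of m a (r + e))"
  proof
    fix b assume "b \<in> B"
    then obtain a where "a \<in> A" "a \<in> mspace m" "b \<in> mspace m" "mdist m a b \<le> r"
      using assms(3) by blast
    then show "b \<in> (\<Union>a\<in>A. mball_of m a (r + e))"
      using e by (auto intro!: bexI[of _ a])
  qed
  ultimately show "hausdorff_distance m A B \<le> r + e"
    unfolding hausdorff_distance_def using assms(1) e
    by (intro cInf_lower) (auto intro: bdd_belowI[of _ 0])
qed

text \<open>
  When no radius is admissible, the Hausdorff distance is the unspecified real \<open>Inf {}\<close>,
  possibly negative.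
\<close>

lemma hausdorff_distance_bounded_below:
  "min 0 (Inf {}) \<le> hausdorff_distance m A B"
proof -
  define S where
    "S = {r. r > 0 \<and> A \<subseteq> (\<Union>b\<in>B. mball_of m b r) \<and> B \<subseteq> (\<Union>a\<in>A. mball_of m a r)}"
  have "min 0 (Inf {}) \<le> Inf S"
  proof (cases "S = {}")
    case False
    then have "0 \<le> Inf S" by (rule cInf_greatest) (simp add: S_def)
    then show ?thesis by simp
  qed simp
  then show ?thesis by (simp add: hausdorff_distance_def S_def)
qed

text \<open>A real infimum lies below its members only if the set is bounded below. The bound
  \<open>min 0 (Inf {})\<close> also covers ambient spaces in which no radius is admissible.\<close>

lemma gromov_hausdorff_distance_le:
  fixes Z :: "('a + 'b) metric" and m1 :: "'a metric" and m2 :: "'b metric"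
  assumes "isometric_embedding m1 Z \<phi>" "isometric_embedding m2 Z \<psi>"
    and "hausdorff_distance Z (\<phi> ` mspace m1) (\<psi> ` mspace m2) \<le> r"
  shows "gromov_hausdorff_distance m1 m2 \<le> r"
proof -
  have "gromov_hausdorff_distance m1 m2
      \<le> hausdorff_distance Z (\<phi> ` mspace m1) (\<psi> ` mspace m2)"
    unfolding gromov_hausdorff_distance_def
    by (rule cInf_lower)
      (use assms(1,2) in \<open>auto intro!: bdd_belowI[of _ "min 0 (Inf {})"]
          hausdorff_distance_bounded_below\<close>)
  with assms(3) show ?thesis by simp
qed

section \<open>Gluing two metric spaces along a correspondence\<close>

locale correspondence =
  fixes m1 :: "'a metric" and m2 :: "'b metric" and R :: "('a \<times> 'b) set" and r :: real
  assumes R_sub: "R \<subseteq> mspace m1 \<times> mspace m2"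
    and R_left: "x \<in> mspace m1 \<Longrightarrow> \<exists>y. (x, y) \<in> R"
    and R_right: "y \<in> mspace m2 \<Longrightarrow> \<exists>x. (x, y) \<in> R"
    and distortion: "(x, y) \<in> R \<Longrightarrow> (x', y') \<in> R \<Longrightarrow> \<bar>mdist m1 x x' - mdist m2 y y'\<bar> \<le> 2 * r"
    and R_nonempty: "R \<noteq> {}"
    and r_pos: "0 < r"
begin

text \<open>The length of a cheapest crossing: walk from \<open>x\<close> to \<open>p\<close>, jump
  to a related \<open>q\<close> at cost \<open>r\<close>, walk on to \<open>y\<close>.\<close>

definition cross :: "'a \<Rightarrow> 'b \<Rightarrow> real" where
  "cross x y = (INF (p, q)\<in>R. mdist m1 x p + r + mdist m2 q y)"

lemma cross_le: "(p, q) \<in> R \<Longrightarrow> cross x y \<le> mdist m1 x p + r + mdist m2 q y"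
  unfolding cross_def using r_pos
  by (intro cINF_lower2[of _ _ "(p, q)"]) (auto intro!: bdd_belowI2[of _ 0])

text \<open>Carrier membership of \<open>p\<close> and \<open>q\<close> is handed to the premise
  because the triangle inequalities applied there require it.\<close>

lemma cross_greatest:
  assumes "\<And>p q. (p, q) \<in> R \<Longrightarrow> p \<in> mspace m1 \<Longrightarrow> q \<in> mspace m2 \<Longrightarrow>
    c \<le> mdist m1 x p + r + mdist m2 q y"
  shows "c \<le> cross x y"
  unfolding cross_def using assms R_sub R_nonempty by (intro cINF_greatest) auto

lemma cross_ge: "r \<le> cross x y"
  by (rule cross_greatest) simp

lemma cross_self:
  assumes "(x, y) \<in> R"
  shows "cross x y \<le> r"
proof -
  have "x \<in> mspace m1" "y \<in> mspace m2" using assms R_sub by auto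
  then show ?thesis using cross_le[OF assms, of x y] by (simp add: Metric_space.mdist_zero[OF Metric_space_mspace_mdist])
qed

text \<open>Each crossing from \<open>x'\<close> extends to one from \<open>x\<close> through the
  same pair, at extra cost at most the distance from \<open>x\<close> to \<open>x'\<close>.\<close>

lemma cross_triangle_left:
  assumes "x \<in> mspace m1" "x' \<in> mspace m1" "y \<in> mspace m2"
  shows "cross x y \<le> mdist m1 x x' + cross x' y"
proof -
  have "cross x y - mdist m1 x x' \<le> cross x' y"
  proof (rule cross_greatest)
    fix p q assume pq: "(p, q) \<in> R" "p \<in> mspace m1" "q \<in> mspace m2"
    then show "cross x y - mdist m1 x x' \<le> mdist m1 x' p + r + mdist m2 q y"
      using cross_le[OF pq(1), of x y] mdist_triangle[of x m1 x' p] assms by linarith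
  qed
  then show ?thesis by linarith
qed

lemma cross_triangle_right:
  assumes "x \<in> mspace m1" "y \<in> mspace m2" "y' \<in> mspace m2"
  shows "cross x y \<le> cross x y' + mdist m2 y' y"
proof -
  have "cross x y - mdist m2 y' y \<le> cross x y'"
  proof (rule cross_greatest)
    fix p q assume pq: "(p, q) \<in> R" "p \<in> mspace m1" "q \<in> mspace m2"
    then show "cross x y - mdist m2 y' y \<le> mdist m1 x p + r + mdist m2 q y'"
      using cross_le[OF pq(1), of x y] mdist_triangle[of q m2 y' y] assms by linarith
  qed
  then show ?thesis by linarith
qed

text \<open>Two crossings that meet at \<open>y\<close> join their exit points \<open>q\<close> and
  \<open>q'\<close> inside \<open>m2\<close>. Replacing this segment by the one from
  \<open>p\<close> to \<open>p'\<close> costs at most the distortion \<open>2 * r\<close>, which the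
  two jumps pay for.\<close>

lemma mdist_left_le_cross:
  assumes "x \<in> mspace m1" "x' \<in> mspace m1" "y \<in> mspace m2"
  shows "mdist m1 x x' \<le> cross x y + cross x' y"
proof -
  have "mdist m1 x x' - cross x' y \<le> cross x y"
  proof (rule cross_greatest)
    fix p q assume pq: "(p, q) \<in> R" "p \<in> mspace m1" "q \<in> mspace m2"
    \<comment> \<open>The first crossing is held fixed while the second infimum is unfolded.\<close>
    have "mdist m1 x x' - (mdist m1 x p + r + mdist m2 q y) \<le> cross x' y"
    proof (rule cross_greatest)
      fix p' q' assume pq': "(p', q') \<in> R" "p' \<in> mspace m1" "q' \<in> mspace m2"
      have "mdist m1 x x' \<le> mdist m1 x p + mdist m1 p p' + mdist m1 x' p'"
        using mdist_triangle[of x m1 p x'] mdist_triangle[of p m1 p' x'] assms pq pq'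
        by (simp add: mdist_commute)
      moreover have "mdist m1 p p' \<le> mdist m2 q q' + 2 * r"
        using distortion[OF pq(1) pq'(1)] by linarith
      moreover have "mdist m2 q q' \<le> mdist m2 q y + mdist m2 q' y"
        using mdist_triangle[of q m2 y q'] assms pq pq' by (simp add: mdist_commute)
      ultimately show "mdist m1 x x' - (mdist m1 x p + r + mdist m2 q y)
          \<le> mdist m1 x' p' + r + mdist m2 q' y"
        by linarith
    qed
    then show "mdist m1 x x' - cross x' y \<le> mdist m1 x p + r + mdist m2 q y" by linarith
  qed
  then show ?thesis by linarith
qed

text \<open>The mirror image: the crossings share the start \<open>x\<close>, and the distortion
  bound is applied in the other direction.\<close>

lemma mdist_right_le_cross:
  assumes "x \<in> mspace m1" "y \<in> mspace m2" "y' \<in> mspace m2"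
  shows "mdist m2 y y' \<le> cross x y + cross x y'"
proof -
  have "mdist m2 y y' - cross x y' \<le> cross x y"
  proof (rule cross_greatest)
    fix p q assume pq: "(p, q) \<in> R" "p \<in> mspace m1" "q \<in> mspace m2"
    have "mdist m2 y y' - (mdist m1 x p + r + mdist m2 q y) \<le> cross x y'"
    proof (rule cross_greatest)
      fix p' q' assume pq': "(p', q') \<in> R" "p' \<in> mspace m1" "q' \<in> mspace m2"
      have "mdist m2 y y' \<le> mdist m2 q y + mdist m2 q q' + mdist m2 q' y'"
        using mdist_triangle[of y m2 q y'] mdist_triangle[of q m2 q' y'] assms pq pq'
        by (simp add: mdist_commute)
      moreover have "mdist m2 q q' \<le> mdist m1 p p' + 2 * r"
        using distortion[OF pq(1) pq'(1)] by linarith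
      moreover have "mdist m1 p p' \<le> mdist m1 x p + mdist m1 x p'"
        using mdist_triangle[of p m1 x p'] assms pq pq' by (simp add: mdist_commute)
      ultimately show "mdist m2 y y' - (mdist m1 x p + r + mdist m2 q y)
          \<le> mdist m1 x p' + r + mdist m2 q' y'"
        by linarith
    qed
    then show "mdist m2 y y' - cross x y' \<le> mdist m1 x p + r + mdist m2 q y" by linarith
  qed
  then show ?thesis by linarith
qed

definition glued_dist :: "'a + 'b \<Rightarrow> 'a + 'b \<Rightarrow> real" where
  "glued_dist u v = (case (u, v) of
      (Inl x, Inl x') \<Rightarrow> mdist m1 x x' | (Inl x, Inr y) \<Rightarrow> cross x y
    | (Inr y, Inl x) \<Rightarrow> cross x y | (Inr y, Inr y') \<Rightarrow> mdist m2 y y')"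

lemma glued_dist_simps [simp]:
  "glued_dist (Inl x) (Inl x') = mdist m1 x x'" "glued_dist (Inl x) (Inr y) = cross x y"
  "glued_dist (Inr y) (Inl x) = cross x y" "glued_dist (Inr y) (Inr y') = mdist m2 y y'"
  by (simp_all add: glued_dist_def)

definition glued :: "('a + 'b) metric" where
  "glued = metric (mspace m1 <+> mspace m2, glued_dist)"

text \<open>Points of different sides are separated because crossings cost at least
  \<open>r > 0\<close>. The triangle inequality splits by the sides of the three points into the
  inequalities above.\<close>

lemma Metric_space_glued: "Metric_space (mspace m1 <+> mspace m2) glued_dist"
proof
  have pos: "0 < cross x y" for x y
    using cross_ge[of x y] r_pos by linarith
  show "0 \<le> glued_dist u v" for u v
    using pos by (cases u; cases v) (auto intro: less_imp_le)
  show "glued_dist u v = glued_dist v u" for u v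
    by (cases u; cases v) (auto simp: mdist_commute)
  show "glued_dist u v = 0 \<longleftrightarrow> u = v"
    if "u \<in> mspace m1 <+> mspace m2" "v \<in> mspace m1 <+> mspace m2" for u v
    using that less_imp_neq[OF pos] by (auto dest: sym)
  show "glued_dist u w \<le> glued_dist u v + glued_dist v w"
    if "u \<in> mspace m1 <+> mspace m2" "v \<in> mspace m1 <+> mspace m2"
      "w \<in> mspace m1 <+> mspace m2" for u v w
    using that
    by (auto simp: mdist_triangle mdist_left_le_cross mdist_right_le_cross
        cross_triangle_left cross_triangle_right)
      \<comment> \<open>The remaining cases traverse a crossing backwards, so distances and summands
        have to be commuted first.\<close>
      (metis cross_triangle_left cross_triangle_right mdist_commute add.commute)+
qed

lemma mspace_glued [simp]: "mspace glued = mspace m1 <+> mspace m2"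
  by (simp add: glued_def Metric_space.mspace_metric[OF Metric_space_glued])

lemma mdist_glued [simp]: "mdist glued = glued_dist"
  by (simp add: glued_def Metric_space.mdist_metric[OF Metric_space_glued])

text \<open>In the glued space every point has a related point on the other side, at distance at
  most \<open>r\<close> by \<open>cross_self\<close>.\<close>

lemma gromov_hausdorff_le: "gromov_hausdorff_distance m1 m2 \<le> r"
proof (rule gromov_hausdorff_distance_le)
  show "isometric_embedding m1 glued Inl" "isometric_embedding m2 glued Inr"
    by (auto simp: isometric_embedding_def)
  show "hausdorff_distance glued (Inl ` mspace m1) (Inr ` mspace m2) \<le> r"
  proof (rule hausdorff_distance_le)
    fix u :: "'a + 'b" assume "u \<in> Inl ` mspace m1"
    then obtain x y where "u = Inl x" "(x, y) \<in> R" using R_left by blast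
    then show "\<exists>v\<in>Inr ` mspace m2. u \<in> mspace glued \<and> v \<in> mspace glued \<and> mdist glued u v \<le> r"
      using cross_self R_sub by (intro bexI[of _ "Inr y"]) auto
  next
    fix v :: "'a + 'b" assume "v \<in> Inr ` mspace m2"
    then obtain x y where "v = Inr y" "(x, y) \<in> R" using R_right by blast
    then show "\<exists>u\<in>Inl ` mspace m1. u \<in> mspace glued \<and> v \<in> mspace glued \<and> mdist glued u v \<le> r"
      using cross_self R_sub by (intro bexI[of _ "Inl x"]) auto
  qed (use r_pos in simp)
qed

end

text \<open>Empty spaces admit no nonempty correspondence. They embed vacuously in the empty metric
  space, where both images are empty.\<close>

lemma gromov_hausdorff_distance_empty:
  assumes "mspace m1 = {}" "mspace m2 = {}"
  shows "gromov_hausdorff_distance m1 m2 \<le> 0"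
  by (rule gromov_hausdorff_distance_le[of _ "metric ({}, \<lambda>_ _. 0)" "\<lambda>_. undefined" _ "\<lambda>_. undefined"])
    (auto simp: isometric_embedding_def assms intro: hausdorff_distance_le)

section \<open>Comparison of the pseudo-distances of two functions\<close>

lemma continuous_map_bounded_on_compact:
  assumes "compact_space X" "continuous_map X euclideanreal f"
  shows "\<exists>B. \<forall>x\<in>topspace X. \<bar>f x\<bar> \<le> B"
proof -
  have "compact (f ` topspace X)"
    using assms image_compactin unfolding compact_space_def by fastforce
  then show ?thesis
    by (auto simp: bounded_iff dest!: compact_imp_bounded)
qed

text \<open>Both suprema run over the same paths, and on each path the infimum shifts by at most
  \<open>s\<close>. The bounds \<open>B\<close> and \<open>C\<close> keep the real infima and
  suprema meaningful. The one-sided form serves both directions.\<close>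

lemma path_level_mono:
  fixes f g :: "'a \<Rightarrow> real"
  assumes pc: "path_connected_space X" and x: "x \<in> topspace X" and y: "y \<in> topspace X"
    and bf: "\<And>z. z \<in> topspace X \<Longrightarrow> \<bar>f z\<bar> \<le> B" and bg: "\<And>z. z \<in> topspace X \<Longrightarrow> \<bar>g z\<bar> \<le> C"
    and le: "\<And>z. z \<in> topspace X \<Longrightarrow> f z \<le> g z + s"
  shows "(SUP \<gamma>\<in>paths_between X x y. INF t\<in>{0..1}. f (\<gamma> t))
    \<le> (SUP \<gamma>\<in>paths_between X x y. INF t\<in>{0..1}. g (\<gamma> t)) + s"
proof (rule cSUP_least)
  show "paths_between X x y \<noteq> {}"
    using pc x y unfolding path_connected_space_def paths_between_def by blast
next
  have in_space: "\<gamma> t \<in> topspace X" if "\<gamma> \<in> paths_between X x y" "t \<in> {0..1}" for \<gamma> t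
    using that unfolding paths_between_def pathin_def
    by (auto dest!: continuous_map_image_subset_topspace)
  have lower: "(INF t\<in>{0..1}. h (\<gamma> t)) \<le> h (\<gamma> t)"
    if "\<gamma> \<in> paths_between X x y" "t \<in> {0..1}" and D: "\<And>z. z \<in> topspace X \<Longrightarrow> \<bar>h z\<bar> \<le> D"
    for h :: "'a \<Rightarrow> real" and D \<gamma> t
  proof (rule cINF_lower[OF _ that(2)])
    show "bdd_below ((\<lambda>t. h (\<gamma> t)) ` {0..1})"
      using D in_space[OF that(1)] by (intro bdd_belowI2[of _ "- D"]) (meson abs_le_D2 minus_le_iff)
  qed
  fix \<gamma> assume \<gamma>: "\<gamma> \<in> paths_between X x y"
  have "(INF t\<in>{0..1}. f (\<gamma> t)) - s \<le> (INF t\<in>{0..1}. g (\<gamma> t))"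
  proof (rule cINF_greatest)
    fix t :: real assume t: "t \<in> {0..1}"
    show "(INF t\<in>{0..1}. f (\<gamma> t)) - s \<le> g (\<gamma> t)"
      using lower[of \<gamma> t f, OF \<gamma> t bf] le[OF in_space[OF \<gamma> t]] by linarith
  qed simp
  also have "\<dots> \<le> (SUP \<gamma>\<in>paths_between X x y. INF t\<in>{0..1}. g (\<gamma> t))"
  proof (rule cSUP_upper[OF \<gamma>])
    show "bdd_above ((\<lambda>\<gamma>. INF t\<in>{0..1}. g (\<gamma> t)) ` paths_between X x y)"
    \<comment> \<open>Every path passes through \<open>x\<close> at time 0, so \<open>g x\<close>
      bounds all the infima.\<close>
    proof (rule bdd_aboveI2)
      fix \<delta> assume "\<delta> \<in> paths_between X x y"
      then show "(INF t\<in>{0..1}. g (\<delta> t)) \<le> g x"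
        using lower[of \<delta> 0 g, OF _ _ bg] by (auto simp: paths_between_def)
    qed
  qed
  finally show "(INF t\<in>{0..1}. f (\<gamma> t))
      \<le> (SUP \<gamma>\<in>paths_between X x y. INF t\<in>{0..1}. g (\<gamma> t)) + s"
    by linarith
qed

lemma abs_le_sup_norm:
  assumes "compact_space X" "continuous_map X euclideanreal h" "x \<in> topspace X"
  shows "\<bar>h x\<bar> \<le> sup_norm X h"
proof -
  have "bdd_above ((\<lambda>x. \<bar>h x\<bar>) ` topspace X)"
    using continuous_map_bounded_on_compact[OF assms(1,2)] by (auto intro: bdd_aboveI2)
  then show ?thesis
    using assms(3) by (auto simp: sup_norm_def intro: cSUP_upper)
qed

text \<open>The factor 4 collects one sup norm from each endpoint value and two from the doubled
  supremum.\<close>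

lemma tree_dist_diff_le:
  assumes compact: "compact_space X" and pc: "path_connected_space X"
    and f: "continuous_map X euclideanreal f" and g: "continuous_map X euclideanreal g"
    and x: "x \<in> topspace X" and y: "y \<in> topspace X"
  shows "\<bar>tree_dist X f x y - tree_dist X g x y\<bar> \<le> 4 * sup_norm X (\<lambda>x. f x - g x)"
proof -
  let ?s = "sup_norm X (\<lambda>x. f x - g x)"
  obtain B C where B: "\<And>z. z \<in> topspace X \<Longrightarrow> \<bar>f z\<bar> \<le> B"
    and C: "\<And>z. z \<in> topspace X \<Longrightarrow> \<bar>g z\<bar> \<le> C"
    using continuous_map_bounded_on_compact compact f g by metis
  have s: "\<bar>f z - g z\<bar> \<le> ?s" if "z \<in> topspace X" for z
    using abs_le_sup_norm[OF compact _ that, of "\<lambda>x. f x - g x"] f g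
    by (simp add: continuous_map_diff)
  have fg: "f z \<le> g z + ?s" and gf: "g z \<le> f z + ?s" if "z \<in> topspace X" for z
    using s[OF that] by linarith+
  show ?thesis
    using path_level_mono[OF pc x y, of f B g C ?s, OF B C fg] path_level_mono[OF pc x y, of g C f B ?s, OF C B gf] s[OF x] s[OF y]
    unfolding tree_dist_def by linarith
qed

section \<open>The correspondence between the two trees\<close>

theorem theorem4p21:
  fixes X :: "'a topology" and f g :: "'a \<Rightarrow> real"
  assumes "compact_space X"
    and "connected_space X"
    and "locally_path_connected_space X"
    and "continuous_map X euclideanreal f"
    and "continuous_map X euclideanreal g"
  shows "gromov_hausdorff_distance (tree X f) (tree X g) \<le> 2 * sup_norm X (\<lambda>x. f x - g x)"
proof -
  have pc: "path_connected_space X"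
    using assms(2,3) path_connected_eq_connected_space by blast
  note mf = tree_metric[OF assms(1) pc assms(4)] and mg = tree_metric[OF assms(1) pc assms(5)]
  show ?thesis
  proof (cases "topspace X = {}")
    case True
    \<comment> \<open>Here \<open>sup_norm\<close> takes its default value 0, so the goal is a bound
      by 0.\<close>
    then have "mspace (tree X f) = {}" "mspace (tree X g) = {}"
      unfolding mf(2) mg(2) by (simp_all only: quotient_empty)
    then show ?thesis
      using gromov_hausdorff_distance_empty[of "tree X f" "tree X g"] True
      unfolding sup_norm_def by (simp only: if_True refl mult_zero_right)
  next
    case False
    define s where "s = sup_norm X (\<lambda>x. f x - g x)"
    \<comment> \<open>Two classes are related when they have a common representative.\<close>
    define R where "R = (\<lambda>x. (tree_rel X f `` {x}, tree_rel X g `` {x})) ` topspace X"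
    obtain x0 where "x0 \<in> topspace X" using False by blast
    then have s0: "0 \<le> s"
      using abs_le_sup_norm[OF assms(1) continuous_map_diff[OF assms(4,5)]] unfolding s_def
      by (meson abs_ge_zero order_trans)
    show ?thesis
    \<comment> \<open>The jump cost must be positive, but \<open>s\<close> vanishes when
      \<open>f\<close> and \<open>g\<close> agree on the space; the slack \<open>e\<close> repairs
      this.\<close>
    proof (rule field_le_epsilon)
      fix e :: real assume e: "0 < e"
      interpret correspondence "tree X f" "tree X g" R "2 * s + e"
      proof
        show "R \<subseteq> mspace (tree X f) \<times> mspace (tree X g)"
          by (auto simp: R_def mf mg quotientI)
        show "\<exists>B. (A, B) \<in> R" if "A \<in> mspace (tree X f)" for A
          using that by (auto simp: R_def mf elim!: quotientE)
        show "\<exists>A. (A, B) \<in> R" if "B \<in> mspace (tree X g)" for B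
          using that by (auto simp: R_def mg elim!: quotientE)
        show "\<bar>mdist (tree X f) A A' - mdist (tree X g) B B'\<bar> \<le> 2 * (2 * s + e)"
          if AB: "(A, B) \<in> R" "(A', B') \<in> R" for A B A' B'
        proof -
          obtain x y where xy: "x \<in> topspace X" "y \<in> topspace X"
            "A = tree_rel X f `` {x}" "B = tree_rel X g `` {x}"
            "A' = tree_rel X f `` {y}" "B' = tree_rel X g `` {y}"
            using AB by (auto simp: R_def)
          show ?thesis
            \<comment> \<open>The distortion is at most \<open>4 * s\<close>, which is below twice
              the jump cost \<open>2 * s + e\<close>.\<close>
            using tree_dist_diff_le[OF assms(1) pc assms(4,5) xy(1,2)] e xy(1,2)
            by (simp add: xy(3-) mf(3) mg(3) s_def)
        qed
        show "R \<noteq> {}" using False by (simp add: R_def)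
        show "0 < 2 * s + e" using s0 e by simp
      qed
      show "gromov_hausdorff_distance (tree X f) (tree X g) \<le> 2 * sup_norm X (\<lambda>x. f x - g x) + e"
        using gromov_hausdorff_le by (simp add: s_def)
    qed
  qed
qed

end
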